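(* Let $B_1$ be a real Banach space and let $P_1$ be a set of representatives for $\mathfrak{F}_{B_1}$. Suppose that $$M_{p,\alpha}=\{a\in S(B_1):p(a)=\alpha\}$$ for every $p\in P_1$ and every real number $\alpha$ with $-1\le\alpha\le1$. Then for every real Banach space $B_2$, every surjective isometry $T:S(B_1)\to S(B_2)$ is extended to a surjective real-linear isometry from $B_1$ onto $B_2$. Hence $B_1$ satisfies the Mazur-Ulam property.
   Context: For a real Banach space $B$, $S(B)=\{a\in B:\|a\|=1\}$ and $\mathfrak{F}_B$ is the family of all maximal convex subsets of $S(B)$. Let $\mathbb{T}=\{\pm1\}$. Let $Q$ be the set of all extreme points $p$ of the closed unit ball of the dual space $B^*$ such that $p^{-1}(1)\cap S(B)\in\mathfrak{F}_B$. (Every $F\in\mathfrak{F}_B$ is of the form $p^{-1}(1)\cap S(B)$ for some $p\in Q$.) For $p_1,p_2\in Q$ write $p_1\sim p_2$ if there is $\gamma\in\mathbb{T}$ with $p_1^{-1}(1)\cap S(B)=(\gamma p_2)^{-1}(1)\cap S(B)$; this is an equivalence relation on $Q$. A set of representatives for $\mathfrak{F}_B$ is a subset $P\subset Q$ containing exactly one element of each equivalence class of $\sim$. For $p\in P$ and $\lambda\in\mathbb{T}$ put $F_{p,\lambda}=\{a\in S(B):p(a)=\lambda\}$, and let $d(a,L)=\inf_{b\in L}\|a-b\|$. For $p\in P$ and $-1\le\alpha\le1$, put $M_{p,\alpha}=\{a\in S(B): d(a,F_{p,\alpha/|\alpha|})\le 1-|\alpha|,\ d(a,F_{p,-\alpha/|\alpha|})\le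 1+|\alpha|\}$, where $\alpha/|\alpha|$ is read as $1$ if $\alpha=0$. Surjective isometries between unit spheres are with respect to the norm metrics, no linearity assumed. A real Banach space $E$ satisfies the Mazur-Ulam property if every surjective isometry from $S(E)$ onto the unit sphere of any real Banach space $B_2$ extends to a surjective real-linear isometry from $E$ onto $B_2$. *)

theory Defs
  imports "HOL-Analysis.Analysis"
begin

text \<open>
  The unit sphere of a space \<open>'a\<close> is \<open>sphere 0 1\<close>, and its dual is the type
  \<open>'a \<Rightarrow>\<^sub>L real\<close> of bounded linear functionals with the operator norm.
\<close>

definition maximal_convex_subsets :: "'a::real_normed_vector set set" where
  "maximal_convex_subsets =
     {F. F \<subseteq> sphere 0 1 \<and> convex F \<and>
         (\<forall>G. G \<subseteq> sphere 0 1 \<and> convex G \<and> F \<subseteq> G \<longrightarrow> G = F)}"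

definition face :: "('a::real_normed_vector \<Rightarrow>\<^sub>L real) \<Rightarrow> real \<Rightarrow> 'a set" where
  "face p c = {a \<in> sphere 0 1. blinfun_apply p a = c}"

text \<open>The set \<open>Q\<close> of extreme points of the dual ball that cut out maximal convex sets.\<close>

definition supporting_extreme_points :: "('a::real_normed_vector \<Rightarrow>\<^sub>L real) set" where
  "supporting_extreme_points =
     {p. p extreme_point_of cball 0 1 \<and> face p 1 \<in> maximal_convex_subsets}"

definition face_equiv ::
    "(('a::real_normed_vector \<Rightarrow>\<^sub>L real) \<times> ('a \<Rightarrow>\<^sub>L real)) set" where
  "face_equiv =
     {(p1, p2). p1 \<in> supporting_extreme_points \<and> p2 \<in> supporting_extreme_points \<and>
                (\<exists>\<gamma>\<in>{1, -1}. face p1 1 = face (\<gamma> *\<^sub>R p2) 1)}"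

definition set_of_representatives :: "('a::real_normed_vector \<Rightarrow>\<^sub>L real) set \<Rightarrow> bool" where
  "set_of_representatives P \<longleftrightarrow>
     P \<subseteq> supporting_extreme_points \<and>
     (\<forall>C \<in> supporting_extreme_points // face_equiv. \<exists>!p. p \<in> P \<and> p \<in> C)"

definition direction :: "real \<Rightarrow> real" where
  "direction \<alpha> = (if \<alpha> = 0 then 1 else \<alpha> / \<bar>\<alpha>\<bar>)"

text \<open>
  The library sets \<open>infdist a {} = 0\<close>. This convention never matters below: if the sphere is
  nonempty and \<open>face p 1\<close> is a maximal convex subset of it, then \<open>face p 1\<close> and
  \<open>face p (-1)\<close> are nonempty, and if the sphere is empty then so is \<open>M_set p \<alpha>\<close>.
\<close>

definition M_set :: "('a::real_normed_vector \<Rightarrow>\<^sub>L real) \<Rightarrow> real \<Rightarrow> 'a set" where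
  "M_set p \<alpha> =
     {a \<in> sphere 0 1. infdist a (face p (direction \<alpha>)) \<le> 1 - \<bar>\<alpha>\<bar> \<and>
                      infdist a (face p (- direction \<alpha>)) \<le> 1 + \<bar>\<alpha>\<bar>}"

definition surjective_isometry_between ::
    "('a::metric_space \<Rightarrow> 'b::metric_space) \<Rightarrow> 'a set \<Rightarrow> 'b set \<Rightarrow> bool" where
  "surjective_isometry_between T A B \<longleftrightarrow>
     T ` A = B \<and> (\<forall>x\<in>A. \<forall>y\<in>A. dist (T x) (T y) = dist x y)"

definition extends_to_linear_isometry ::
    "('a::real_normed_vector \<Rightarrow> 'b::real_normed_vector) \<Rightarrow> bool" where
  "extends_to_linear_isometry T \<longleftrightarrow>
     (\<exists>U. linear U \<and> surjective_isometry_between U UNIV UNIV \<and> (\<forall>a\<in>sphere 0 1. U a = T a))"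

text \<open>
  HOL cannot quantify over types inside a formula, so the Mazur-Ulam property takes the
  target space as a second type argument. The space \<open>'a\<close> has the property if
  \<open>mazur_ulam TYPE('a) TYPE('b)\<close> holds for every \<open>'b::banach\<close>, that is, if it is a theorem
  with \<open>'b\<close> a free type variable.
\<close>

definition mazur_ulam :: "'a::banach itself \<Rightarrow> 'b::banach itself \<Rightarrow> bool" where
  "mazur_ulam _ _ \<longleftrightarrow>
     (\<forall>T :: 'a \<Rightarrow> 'b. surjective_isometry_between T (sphere 0 1) (sphere 0 1) \<longrightarrow>
        extends_to_linear_isometry T)"

lemma face_scaleR_minus_one: "face (- p) 1 = uminus ` face p 1"
proof -
  have "a \<in> face (- p) 1 \<longleftrightarrow> - a \<in> face p 1" for a
    by (auto simp: face_def blinfun.minus_left blinfun.minus_right)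
  then show ?thesis
    by (force simp: image_iff)
qed

lemma equiv_face_equiv: "equiv supporting_extreme_points face_equiv"
proof -
  have cancel: "uminus ` uminus ` A = A" for A :: "'a set"
    by (simp add: image_image)
  have inv: "face p 1 = uminus ` face q 1 \<longleftrightarrow> face q 1 = uminus ` face p 1"
    for p q :: "'a \<Rightarrow>\<^sub>L real"
    using cancel by metis
  have rel: "(p, q) \<in> face_equiv \<longleftrightarrow> p \<in> supporting_extreme_points \<and> q \<in> supporting_extreme_points \<and>
      (face p 1 = face q 1 \<or> face p 1 = uminus ` face q 1)" for p q :: "'a \<Rightarrow>\<^sub>L real"
    by (auto simp: face_equiv_def face_scaleR_minus_one)
  show ?thesis
  proof (rule equivI)
    show "face_equiv \<subseteq> supporting_extreme_points \<times> (supporting_extreme_points :: ('a \<Rightarrow>\<^sub>L real) set)"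
      by (auto simp: face_equiv_def)
    show "refl_on supporting_extreme_points (face_equiv :: (('a \<Rightarrow>\<^sub>L real) \<times> _) set)"
      by (auto simp: refl_on_def rel)
    show "sym (face_equiv :: (('a \<Rightarrow>\<^sub>L real) \<times> _) set)"
      unfolding sym_def rel using inv by blast
    show "trans (face_equiv :: (('a \<Rightarrow>\<^sub>L real) \<times> _) set)"
      unfolding trans_def rel by (metis cancel)
  qed
qed

end

theory Submission imports Defs begin

text \<open>
  Every nonempty maximal convex subset \<open>F\<close> of a unit sphere is a face \<open>p = 1\<close> of an extreme
  functional \<open>p\<close>. Zorn's lemma on sublinear functionals yields Hahn-Banach and extremality at
  once: a minimal sublinear functional whose minorants form a face of the dual ball is linear,
  so that face is a single point.

  An isometry \<open>T\<close> preserves the relation \<open>norm (x - y) = 2\<close>, hence maps maximal convex subsets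
  to maximal convex subsets, and antipodal ones to antipodal ones. So \<open>T\<close> maps the faces
  \<open>p = 1\<close> and \<open>p = -1\<close> to faces \<open>q = 1\<close> and \<open>q = -1\<close>. The hypothesis on \<open>M_set p \<alpha>\<close> says that
  \<open>p a\<close> is determined by the distances from \<open>a\<close> to the former, and since \<open>q\<close> is 1-Lipschitz this
  forces \<open>q (T a) = p a\<close>. The functionals \<open>q\<close> so obtained separate points, which makes the
  positively homogeneous extension of \<open>T\<close> linear.
\<close>

section \<open>Sublinear functionals and extreme points of the dual ball\<close>

definition sublinear :: "('a::real_vector \<Rightarrow> real) \<Rightarrow> bool" where
  "sublinear s \<longleftrightarrow> (\<forall>x y. s (x + y) \<le> s x + s y) \<and> (\<forall>k\<ge>0. \<forall>x. s (k *\<^sub>R x) = k * s x)"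

text \<open>The linear functionals below \<open>s'\<close> form a face of the set of those below \<open>s\<close>.\<close>

definition facial_in :: "('a::real_vector \<Rightarrow> real) \<Rightarrow> ('a \<Rightarrow> real) \<Rightarrow> bool" where
  "facial_in s' s \<longleftrightarrow>
     (\<forall>p q u. linear p \<and> linear q \<and> p \<le> s \<and> q \<le> s \<and> 0 < u \<and> u < 1 \<and>
        (\<forall>x. (1 - u) * p x + u * q x \<le> s' x) \<longrightarrow> p \<le> s' \<and> q \<le> s')"

text \<open>If \<open>s = c\<close> on \<open>A\<close>, the linear functionals below \<open>tighten s c A\<close> are those
  below \<open>s\<close> that equal \<open>c\<close> on \<open>A\<close>.\<close>

definition tighten :: "('a::real_vector \<Rightarrow> real) \<Rightarrow> real \<Rightarrow> 'a set \<Rightarrow> 'a \<Rightarrow> real" where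
  "tighten s c A y = (INF z\<in>A \<times> {0..}. s (y + snd z *\<^sub>R fst z) - snd z * c)"

text \<open>Applying the inequality with \<open>inverse k\<close> to \<open>k *\<^sub>R x\<close>
  gives its converse; the value at 0 settles \<open>k = 0\<close>.\<close>

lemma sublinearI:
  assumes "\<And>x y. s (x + y) \<le> s x + s y" and "s 0 = 0"
    and le: "\<And>k x. k > 0 \<Longrightarrow> s (k *\<^sub>R x) \<le> k * s x"
  shows "sublinear s"
proof -
  have "s (k *\<^sub>R x) = k * s x" if "k \<ge> 0" for k x
  proof (cases "k = 0")
    case False
    then have k: "k > 0"
      using that by simp
    have "s x \<le> inverse k * s (k *\<^sub>R x)"
      using le[of "inverse k" "k *\<^sub>R x"] k by simp
    then have "k * s x \<le> s (k *\<^sub>R x)"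
      using k by (simp add: field_simps)
    then show ?thesis
      using le[OF k, of x] by simp
  qed (simp add: assms)
  then show ?thesis
    using assms(1) by (simp add: sublinear_def)
qed

lemma sublinear_add: "sublinear s \<Longrightarrow> s (x + y) \<le> s x + s y"
  and sublinear_scale: "sublinear s \<Longrightarrow> k \<ge> 0 \<Longrightarrow> s (k *\<^sub>R x) = k * s x"
  by (auto simp: sublinear_def)

lemma sublinear_zero: "sublinear s \<Longrightarrow> s 0 = 0"
  using sublinear_scale[of s 0 0] by simp

lemma sublinear_minus: "sublinear s \<Longrightarrow> - s (- x) \<le> s x"
  using sublinear_add[of s x "- x"] sublinear_zero[of s] by simp

lemma sublinear_norm: "sublinear (norm :: 'a::real_normed_vector \<Rightarrow> real)"
  by (simp add: sublinear_def norm_triangle_ineq)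

text \<open>By oddness, subadditivity at \<open>- x\<close> and \<open>- y\<close> is
  superadditivity at \<open>x\<close> and \<open>y\<close>; negative scalars reduce to positive
  ones.\<close>

lemma odd_sublinear_imp_linear:
  assumes s: "sublinear s" and odd: "\<And>x. s (- x) \<le> - s x"
  shows "linear s"
proof
  have odd': "s (- x) = - s x" for x
    using odd[of x] sublinear_minus[OF s, of x] by simp
  show "s (x + y) = s x + s y" for x y
    using sublinear_add[OF s, of x y] sublinear_add[OF s, of "- x" "- y"] odd'[of "x + y"]
    by (simp add: odd')
  show "s (k *\<^sub>R x) = k *\<^sub>R s x" for k x
  proof (cases "k \<ge> 0")
    case False
    then have "s ((- k) *\<^sub>R x) = (- k) * s x"
      by (intro sublinear_scale[OF s]) simp
    then show ?thesis
      using odd'[of "k *\<^sub>R x"] by simp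
  qed (simp add: sublinear_scale[OF s])
qed

section \<open>Tightening a sublinear functional along a convex set\<close>

context
  fixes s :: "'a::real_vector \<Rightarrow> real" and c :: real and A :: "'a set"
  assumes s: "sublinear s" and A: "convex A" "A \<noteq> {}" and c: "\<And>a. a \<in> A \<Longrightarrow> s a = c"
begin

text \<open>Keeps the infimum in \<open>tighten\<close> finite: the bound depends on neither
  \<open>a\<close> nor \<open>t\<close>.\<close>

lemma tighten_term_bound:
  assumes "a \<in> A" "t \<ge> 0"
  shows "- s (- y) \<le> s (y + t *\<^sub>R a) - t * c"
  using sublinear_add[OF s, of "y + t *\<^sub>R a" "- y"] sublinear_scale[OF s assms(2), of a] c[OF assms(1)]
  by simp

lemma tighten_le_term:
  assumes "a \<in> A" "t \<ge> 0"
  shows "tighten s c A y \<le> s (y + t *\<^sub>R a) - t * c"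
proof -
  have "bdd_below ((\<lambda>z. s (y + snd z *\<^sub>R fst z) - snd z * c) ` (A \<times> {0..}))"
    by (rule bdd_belowI2[of _ "- s (- y)"]) (auto simp: tighten_term_bound)
  from cINF_lower[OF this, of "(a, t)"] show ?thesis
    using assms by (simp add: tighten_def)
qed

lemma tighten_greatest:
  assumes "\<And>a t. a \<in> A \<Longrightarrow> t \<ge> 0 \<Longrightarrow> z \<le> s (y + t *\<^sub>R a) - t * c"
  shows "z \<le> tighten s c A y"
  unfolding tighten_def using assms A by (intro cINF_greatest) auto

lemma tighten_le: "tighten s c A \<le> s"
proof (rule le_funI)
  fix y
  obtain a where "a \<in> A"
    using A by blast
  then show "tighten s c A y \<le> s y"
    using tighten_le_term[of a 0 y] by simp
qed

text \<open>The term with \<open>t = 1\<close> is \<open>s 0 - c\<close>. For a linear functional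
  below \<open>tighten s c A\<close> this yields the value at least \<open>c\<close> at
  \<open>a\<close>.\<close>

lemma tighten_minus: "a \<in> A \<Longrightarrow> tighten s c A (- a) \<le> - c"
  using tighten_le_term[of a 1 "- a"] sublinear_zero[OF s] by simp

text \<open>Subadditivity rests on the convexity of \<open>A\<close>: shifts along two points of
  \<open>A\<close> add up to a shift along a single point of \<open>A\<close>.\<close>

lemma sublinear_tighten: "sublinear (tighten s c A)"
proof (rule sublinearI)
  show "tighten s c A 0 = 0"
  proof (rule antisym)
    show "tighten s c A 0 \<le> 0"
      using le_funD[OF tighten_le, of 0] sublinear_zero[OF s] by simp
    show "0 \<le> tighten s c A 0"
      using tighten_term_bound[of _ _ 0] sublinear_zero[OF s] by (intro tighten_greatest) simp
  qed
  show "tighten s c A (k *\<^sub>R x) \<le> k * tighten s c A x" if k: "k > 0" for k x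
  proof -
    have "tighten s c A (k *\<^sub>R x) / k \<le> tighten s c A x"
    proof (rule tighten_greatest)
      fix a t assume at: "a \<in> A" "(t::real) \<ge> 0"
      \<comment> \<open>The parameter \<open>t\<close> at \<open>x\<close> corresponds to
        \<open>k * t\<close> at \<open>k *\<^sub>R x\<close>.\<close>
      have "tighten s c A (k *\<^sub>R x) \<le> s (k *\<^sub>R (x + t *\<^sub>R a)) - (k * t) * c"
        using tighten_le_term[of a "k * t" "k *\<^sub>R x"] at k by (simp add: scaleR_add_right)
      also have "\<dots> = k * (s (x + t *\<^sub>R a) - t * c)"
        using sublinear_scale[OF s, of k "x + t *\<^sub>R a"] k by (simp add: algebra_simps)
      finally show "tighten s c A (k *\<^sub>R x) / k \<le> s (x + t *\<^sub>R a) - t * c"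
        using k by (simp add: field_simps)
    qed
    then show ?thesis
      using k by (simp add: field_simps)
  qed
  show "tighten s c A (x + y) \<le> tighten s c A x + tighten s c A y" for x y
  proof -
    have *: "tighten s c A (x + y) \<le> (s (x + t *\<^sub>R a) - t * c) + (s (y + r *\<^sub>R b) - r * c)"
      if ab: "a \<in> A" "b \<in> A" and tr: "t \<ge> 0" "r \<ge> 0" for a b t r
    proof (cases "t + r = 0")
      \<comment> \<open>With both weights zero there is no weighted mean of \<open>a\<close> and
        \<open>b\<close>; subadditivity of \<open>s\<close> itself gives the bound.\<close>
      case True
      then have "t = 0" "r = 0"
        using tr by auto
      moreover have "tighten s c A (x + y) \<le> s (x + y)"
        using tighten_le by (rule le_funD)
      ultimately show ?thesis
        using sublinear_add[OF s, of x y] by simp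
    next
      case False
      then have pos: "t + r > 0"
        using tr by simp
      define d where "d = (t / (t + r)) *\<^sub>R a + (r / (t + r)) *\<^sub>R b"
      have "d \<in> A"
        unfolding d_def using pos tr ab A
        by (intro convexD) (auto simp: add_divide_distrib[symmetric])
      moreover have "(t + r) *\<^sub>R d = t *\<^sub>R a + r *\<^sub>R b"
        using pos by (simp add: d_def scaleR_add_right)
      ultimately have "tighten s c A (x + y) \<le> s ((x + t *\<^sub>R a) + (y + r *\<^sub>R b)) - (t + r) * c"
        using tighten_le_term[of d "t + r" "x + y"] pos by (simp add: algebra_simps)
      then show ?thesis
        using sublinear_add[OF s, of "x + t *\<^sub>R a" "y + r *\<^sub>R b"] by (simp add: algebra_simps)
    qed
    have "tighten s c A (x + y) - tighten s c A x \<le> tighten s c A y"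
    proof (rule tighten_greatest)
      fix b r assume br: "b \<in> A" "(r::real) \<ge> 0"
      have "tighten s c A (x + y) - (s (y + r *\<^sub>R b) - r * c) \<le> tighten s c A x"
        using *[OF _ br(1) _ br(2)] by (intro tighten_greatest) (simp add: algebra_simps)
      then show "tighten s c A (x + y) - tighten s c A x \<le> s (y + r *\<^sub>R b) - r * c"
        by simp
    qed
    then show ?thesis
      by simp
  qed
qed

text \<open>At \<open>a\<close> in \<open>A\<close> both \<open>p a\<close> and \<open>q a\<close>
  are at most \<open>c\<close>, while their mixture is at least \<open>c\<close>; so both equal
  \<open>c\<close>.\<close>

lemma facial_in_tighten: "facial_in (tighten s c A) s"
  unfolding facial_in_def
proof (intro allI impI, elim conjE)
  fix p q :: "'a \<Rightarrow> real" and u :: real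
  assume lin: "linear p" "linear q" and le: "p \<le> s" "q \<le> s" and u: "0 < u" "u < 1"
    and mix: "\<forall>x. (1 - u) * p x + u * q x \<le> tighten s c A x"
  \<comment> \<open>Such an \<open>f\<close> lies below every term of the infimum: the shift by
    \<open>t *\<^sub>R a\<close> raises \<open>f\<close> by exactly the \<open>t * c\<close> that is
    subtracted.\<close>
  have below: "f \<le> tighten s c A" if f: "linear f" "f \<le> s" "\<And>a. a \<in> A \<Longrightarrow> f a = c" for f
  proof (rule le_funI, rule tighten_greatest)
    fix y a t assume at: "a \<in> A" "(t::real) \<ge> 0"
    have "f (y + t *\<^sub>R a) = f y + t * c"
      using f(1) f(3)[OF at(1)] by (simp add: linear_add linear_cmul)
    then show "f y \<le> s (y + t *\<^sub>R a) - t * c"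
      using le_funD[OF f(2), of "y + t *\<^sub>R a"] by simp
  qed
  have "p a = c \<and> q a = c" if a: "a \<in> A" for a
  proof -
    have "c \<le> (1 - u) * p a + u * q a"
      using mix[rule_format, of "- a"] tighten_minus[OF a] lin by (simp add: linear_neg)
    moreover have pq: "p a \<le> c" "q a \<le> c"
      using le[THEN le_funD, of a] c[OF a] by auto
    moreover have "(1 - u) * p a \<le> (1 - u) * c" "u * q a \<le> u * c"
      using pq u by (auto intro: mult_left_mono)
    moreover have "(1 - u) * c + u * c = c"
      by (simp add: algebra_simps)
    ultimately have "(1 - u) * p a = (1 - u) * c" "u * q a = u * c"
      by linarith+
    then show ?thesis
      using u by simp
  qed
  then show "p \<le> tighten s c A \<and> q \<le> tighten s c A"
    using below lin le by blast
qed

end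

section \<open>Minimal facial functionals by Zorn's lemma\<close>

lemma facial_in_refl: "facial_in s s"
  by (auto simp: facial_in_def)

lemma facial_in_trans:
  assumes "facial_in s2 s1" "facial_in s1 s" "s2 \<le> s1"
  shows "facial_in s2 s"
  unfolding facial_in_def
proof (intro allI impI, elim conjE)
  fix p q :: "'a \<Rightarrow> real" and u :: real
  assume *: "linear p" "linear q" "p \<le> s" "q \<le> s" "0 < u" "u < 1"
    and mix: "\<forall>x. (1 - u) * p x + u * q x \<le> s2 x"
  from mix assms(3) have "\<forall>x. (1 - u) * p x + u * q x \<le> s1 x"
    by (meson le_funD order_trans)
  with * assms(2) have "p \<le> s1 \<and> q \<le> s1"
    unfolding facial_in_def by blast
  with * mix assms(1) show "p \<le> s2 \<and> q \<le> s2"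
    unfolding facial_in_def by blast
qed

text \<open>The bound is the pointwise infimum, finite because each \<open>f\<close> in
  \<open>C\<close> satisfies \<open>- s (- x) \<le> f x\<close>. It is subadditive because the
  smaller of two members of the chain serves at both \<open>x\<close> and \<open>y\<close>.\<close>

lemma sublinear_facial_chain_bound:
  assumes s: "sublinear s" and C: "C \<noteq> {}" "\<And>f. f \<in> C \<Longrightarrow> sublinear f \<and> f \<le> s \<and> facial_in f s"
    and chain: "\<And>f g. f \<in> C \<Longrightarrow> g \<in> C \<Longrightarrow> f \<le> g \<or> g \<le> f"
  obtains i where "sublinear i" "i \<le> s" "facial_in i s" "\<And>f. f \<in> C \<Longrightarrow> i \<le> f"
proof
  define i where "i x = (INF f\<in>C. f x)" for x
  have bdd: "bdd_below ((\<lambda>f. f x) ` C)" for x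
  proof (rule bdd_belowI2)
    fix f assume "f \<in> C"
    then show "- s (- x) \<le> f x"
      using C(2)[of f] sublinear_minus[of f x] le_funD[of f s "- x"] by simp
  qed
  have lower: "i x \<le> f x" if "f \<in> C" for f x
    unfolding i_def using bdd that by (rule cINF_lower)
  have greatest: "z \<le> i x" if "\<And>f. f \<in> C \<Longrightarrow> z \<le> f x" for z x
    unfolding i_def using C(1) that by (rule cINF_greatest)
  show "i \<le> f" if "f \<in> C" for f
    using lower[OF that] by (rule le_funI)
  then show "i \<le> s"
    using C by (meson all_not_in_conv order_trans)
  show "facial_in i s"
    unfolding facial_in_def
  proof (intro allI impI, elim conjE)
    fix p q :: "'a \<Rightarrow> real" and u :: real
    assume *: "linear p" "linear q" "p \<le> s" "q \<le> s" "0 < u" "u < 1"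
      and mix: "\<forall>x. (1 - u) * p x + u * q x \<le> i x"
    have "p \<le> f \<and> q \<le> f" if "f \<in> C" for f
    proof -
      have "\<forall>x. (1 - u) * p x + u * q x \<le> f x"
        using mix lower[OF that] order_trans by blast
      then show ?thesis
        using C(2)[OF that] * unfolding facial_in_def by blast
    qed
    then show "p \<le> i \<and> q \<le> i"
      by (auto simp: le_fun_def intro!: greatest)
  qed
  show "sublinear i"
  proof (rule sublinearI)
    have zero: "f 0 = 0" if "f \<in> C" for f
      using C(2)[OF that] sublinear_zero by blast
    obtain f where "f \<in> C"
      using C(1) by blast
    then show "i 0 = 0"
      using lower[of f 0] greatest[of 0 0] zero by fastforce
    show "i (k *\<^sub>R x) \<le> k * i x" if k: "k > 0" for k x
    proof -
      have "i (k *\<^sub>R x) / k \<le> i x"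
      proof (rule greatest)
        fix f assume f: "f \<in> C"
        then show "i (k *\<^sub>R x) / k \<le> f x"
          using lower[OF f, of "k *\<^sub>R x"] C(2)[OF f] k by (simp add: sublinear_scale field_simps)
      qed
      then show ?thesis
        using k by (simp add: field_simps)
    qed
    show "i (x + y) \<le> i x + i y" for x y
    proof -
      have *: "i (x + y) \<le> f x + g y" if fg: "f \<in> C" "g \<in> C" for f g
      proof -
        obtain m where m: "m \<in> C" "m \<le> f" "m \<le> g"
          using chain[OF fg] fg by blast
        have "i (x + y) \<le> m x + m y"
          using lower[OF m(1)] C(2)[OF m(1)] sublinear_add order_trans by blast
        also have "\<dots> \<le> f x + g y"
          using m by (intro add_mono) (auto simp: le_fun_def)
        finally show ?thesis .
      qed
      have "i (x + y) - i x \<le> i y"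
      proof (rule greatest)
        fix g assume g: "g \<in> C"
        have "i (x + y) - g y \<le> i x"
          using *[OF _ g] by (intro greatest) (simp add: algebra_simps)
        then show "i (x + y) - i x \<le> g y"
          by simp
      qed
      then show ?thesis
        by simp
    qed
  qed
qed

text \<open>A minimal facial sublinear functional cannot be tightened at any point, which makes it odd.\<close>

lemma exists_linear_facial_in:
  fixes s :: "'a::real_vector \<Rightarrow> real"
  assumes s: "sublinear s"
  obtains f where "linear f" "f \<le> s" "facial_in f s"
proof -
  define K where "K = {f. sublinear f \<and> f \<le> s \<and> facial_in f s}"
  \<comment> \<open>The order is reversed, so the maximal element that Zorn's lemma provides is a
    minimal functional.\<close>
  have "\<exists>m\<in>K. \<forall>f\<in>K. m \<ge> f \<longrightarrow> f = m"
  proof (rule predicate_Zorn)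
    show "partial_order_on K (relation_of (\<ge>) K)"
      by (rule partial_order_on_relation_ofI) auto
    fix C assume C: "C \<in> Chains (relation_of (\<ge>) K)"
    then have sub: "C \<subseteq> K"
      by (auto simp: Chains_def relation_of_def)
    show "\<exists>i\<in>K. \<forall>f\<in>C. f \<ge> i"
    proof (cases "C = {}")
      case True
      then show ?thesis
        using s facial_in_refl by (auto simp: K_def)
    next
      case False
      obtain i where "sublinear i" "i \<le> s" "facial_in i s" "\<And>f. f \<in> C \<Longrightarrow> i \<le> f"
      proof (rule sublinear_facial_chain_bound[OF s False])
        show "sublinear f \<and> f \<le> s \<and> facial_in f s" if "f \<in> C" for f
          using that sub by (auto simp: K_def)
        show "f \<le> g \<or> g \<le> f" if "f \<in> C" "g \<in> C" for f g
          using C that by (auto simp: Chains_def relation_of_def)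
      qed blast
      then show ?thesis
        by (auto simp: K_def)
    qed
  qed
  then obtain m where m: "sublinear m" "m \<le> s" "facial_in m s"
    and min: "\<And>f. f \<in> K \<Longrightarrow> f \<le> m \<Longrightarrow> f = m"
    by (auto simp: K_def)
  have "m (- x) \<le> - m x" for x
  proof -
    note tight = m(1) convex_singleton insert_not_empty
    have eq: "\<And>a. a \<in> {x} \<Longrightarrow> m a = m x"
      by simp
    \<comment> \<open>Tightening at \<open>x\<close> with the value \<open>m x\<close> stays in
      \<open>K\<close>, so minimality gives \<open>?t = m\<close>, and the bound at
      \<open>- x\<close> is then oddness of \<open>m\<close>.\<close>
    let ?t = "tighten m (m x) {x}"
    have "?t \<le> m" "sublinear ?t" "facial_in ?t m"
      using tighten_le[OF tight eq] sublinear_tighten[OF tight eq] facial_in_tighten[OF tight eq]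
      by auto
    then have "?t = m"
      using m by (intro min) (auto simp: K_def intro: facial_in_trans)
    moreover have "?t (- x) \<le> - m x"
      by (rule tighten_minus[OF tight eq]) auto
    ultimately show ?thesis
      by simp
  qed
  then have "linear m"
    using m(1) odd_sublinear_imp_linear by blast
  then show thesis
    using that m by blast
qed

section \<open>Extreme functionals supporting a convex set\<close>

lemma blinfun_abs_le_norm:
  assumes "norm (p :: 'a::real_normed_vector \<Rightarrow>\<^sub>L real) \<le> 1"
  shows "\<bar>blinfun_apply p x\<bar> \<le> norm x"
proof -
  have "\<bar>blinfun_apply p x\<bar> \<le> norm p * norm x"
    using norm_blinfun[of p x] by simp
  also have "\<dots> \<le> 1 * norm x"
    using assms by (intro mult_right_mono) auto
  finally show ?thesis
    by simp
qed

text \<open>Tightening the norm forces the value 1 on \<open>A\<close>. A linear \<open>f\<close>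
  facial in the tightened norm is facial in \<open>norm\<close> by transitivity, and its only linear
  minorant is itself; so it is an extreme point.\<close>

lemma exists_extreme_supporting_functional:
  fixes A :: "'a::real_normed_vector set"
  assumes A: "convex A" "A \<noteq> {}" "A \<subseteq> sphere 0 1"
  obtains p :: "'a \<Rightarrow>\<^sub>L real"
  where "p extreme_point_of cball 0 1" "\<And>a. a \<in> A \<Longrightarrow> blinfun_apply p a = 1"
proof -
  have one: "norm a = 1" if "a \<in> A" for a
    using that A by auto
  let ?t = "tighten norm 1 A"
  note tight = sublinear_norm A(1,2) one
  obtain f where f: "linear f" "f \<le> ?t" "facial_in f ?t"
    using exists_linear_facial_in[OF sublinear_tighten[OF tight]] by blast
  have f_norm: "f \<le> norm"
    using f(2) tighten_le[OF tight] by (rule order_trans)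
  have facial: "facial_in f norm"
    using facial_in_trans f facial_in_tighten[OF tight] by blast
  have f_abs: "\<bar>f x\<bar> \<le> norm x" for x
    using le_funD[OF f_norm, of x] le_funD[OF f_norm, of "- x"] linear_neg[OF f(1), of x] by simp
  then have "bounded_linear f"
    using f(1) by (intro linear_conv_bounded_linear[THEN iffD1] bounded_linear_intro[of _ 1])
      (auto simp: linear_add linear_cmul)
  then obtain p where p: "blinfun_apply p = f"
    by (metis bounded_linear_Blinfun_apply)
  have "norm p \<le> 1"
    using f_abs by (intro norm_blinfun_bound) (auto simp: p)
  moreover have "p \<notin> open_segment a b" if ab: "a \<in> cball 0 1" "b \<in> cball 0 1" for a b
  proof
    assume "p \<in> open_segment a b"
    then obtain u where ne: "a \<noteq> b" and u: "0 < u" "u < 1" and eq: "p = (1 - u) *\<^sub>R a + u *\<^sub>R b"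
      by (auto simp: in_segment)
    have le_norm: "blinfun_apply g \<le> norm" if "g \<in> cball 0 1" for g :: "'a \<Rightarrow>\<^sub>L real"
      using blinfun_abs_le_norm[of g] that by (auto simp: abs_le_iff intro!: le_funI)
    have lin: "linear (blinfun_apply g)" for g :: "'a \<Rightarrow>\<^sub>L real"
      by (simp add: blinfun.bounded_linear_right bounded_linear.linear)
    have "\<forall>x. (1 - u) * blinfun_apply a x + u * blinfun_apply b x \<le> f x"
      unfolding p[symmetric] eq by (simp add: blinfun.add_left blinfun.scaleR_left)
    then have le: "blinfun_apply a \<le> f" "blinfun_apply b \<le> f"
      using facial lin le_norm[OF ab(1)] le_norm[OF ab(2)] u unfolding facial_in_def by blast+
    \<comment> \<open>Comparing at \<open>x\<close> and at \<open>- x\<close> turns the inequality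
      between linear functionals into equality.\<close>
    have "g = p" if "blinfun_apply g \<le> f" for g
    proof (rule blinfun_eqI)
      fix x
      show "blinfun_apply g x = blinfun_apply p x"
        using le_funD[OF that, of x] le_funD[OF that, of "- x"] linear_neg[OF f(1), of x]
        by (simp add: p blinfun.minus_right)
    qed
    with le have "a = p" "b = p"
      by auto
    with ne show False
      by simp
  qed
  ultimately have "p extreme_point_of cball 0 1"
    by (simp add: extreme_point_of_def)
  moreover have "blinfun_apply p a = 1" if a: "a \<in> A" for a
  proof -
    have "f (- a) \<le> - 1"
      using le_funD[OF f(2), of "- a"] tighten_minus[OF tight a] by simp
    then show ?thesis
      using linear_neg[OF f(1), of a] f_abs[of a] one[OF a] by (simp add: p)
  qed
  ultimately show thesis
    using that by blast
qed

section \<open>Maximal convex subsets of the unit sphere\<close>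

lemma convex_face:
  assumes "norm p \<le> 1"
  shows "convex (face p 1)"
proof (rule convexI)
  fix x y and u v :: real
  assume *: "x \<in> face p 1" "y \<in> face p 1" "0 \<le> u" "0 \<le> v" "u + v = 1"
  have "norm (u *\<^sub>R x + v *\<^sub>R y) \<le> 1"
    using norm_triangle_ineq[of "u *\<^sub>R x" "v *\<^sub>R y"] * by (simp add: face_def)
  moreover have "blinfun_apply p (u *\<^sub>R x + v *\<^sub>R y) = 1"
    using * by (simp add: face_def blinfun.add_right blinfun.scaleR_right)
  ultimately show "u *\<^sub>R x + v *\<^sub>R y \<in> face p 1"
    using blinfun_abs_le_norm[OF assms, of "u *\<^sub>R x + v *\<^sub>R y"] by (simp add: face_def)
qed

lemma maximal_convex_subsetsD:
  assumes "F \<in> maximal_convex_subsets"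
  shows "F \<subseteq> sphere 0 1" "convex F"
    and "\<And>G. G \<subseteq> sphere 0 1 \<Longrightarrow> convex G \<Longrightarrow> F \<subseteq> G \<Longrightarrow> G = F"
  using assms by (auto simp: maximal_convex_subsets_def)

lemma maximal_convex_subset_eq_face:
  assumes F: "F \<in> maximal_convex_subsets" and p: "norm p \<le> 1"
    and one: "\<And>a. a \<in> F \<Longrightarrow> blinfun_apply p a = 1"
  shows "F = face p 1"
proof -
  have "F \<subseteq> face p 1" "face p 1 \<subseteq> sphere 0 1"
    using maximal_convex_subsetsD(1)[OF F] one by (auto simp: face_def)
  then show ?thesis
    using maximal_convex_subsetsD(3)[OF F] convex_face[OF p] by blast
qed

lemma supporting_extreme_points_norm:
  "p \<in> supporting_extreme_points \<Longrightarrow> norm p \<le> 1"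
  by (simp add: supporting_extreme_points_def extreme_point_of_def)

lemma maximal_convex_subset_is_extreme_face:
  fixes F :: "'a::real_normed_vector set"
  assumes F: "F \<in> maximal_convex_subsets" "F \<noteq> {}"
  obtains p where "p \<in> supporting_extreme_points" "F = face p 1"
proof -
  note FD = maximal_convex_subsetsD[OF F(1)]
  obtain p :: "'a \<Rightarrow>\<^sub>L real"
    where p: "p extreme_point_of cball 0 1" "\<And>a. a \<in> F \<Longrightarrow> blinfun_apply p a = 1"
    using exists_extreme_supporting_functional[OF FD(2) F(2) FD(1)] by blast
  then have "norm p \<le> 1"
    by (simp add: extreme_point_of_def)
  then have eq: "F = face p 1"
    by (rule maximal_convex_subset_eq_face[OF F(1) _ p(2)])
  then have "p \<in> supporting_extreme_points"
    using p(1) F(1) by (simp add: supporting_extreme_points_def)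
  then show thesis
    using eq by (rule that)
qed

text \<open>The empty set is maximal only if the sphere is empty; otherwise the singleton of a unit
  vector enlarges it.\<close>

lemma maximal_convex_subset_nonempty:
  fixes F :: "'a::real_normed_vector set" and x :: 'a
  assumes "F \<in> maximal_convex_subsets" "x \<in> sphere 0 1"
  shows "F \<noteq> {}"
  using maximal_convex_subsetsD(3)[OF assms(1), of "{x}"] assms(2) by force

lemma exists_maximal_convex_subset:
  fixes x :: "'a::real_normed_vector"
  assumes x: "x \<in> sphere 0 1"
  obtains F where "F \<in> maximal_convex_subsets" "x \<in> F"
proof -
  let ?K = "{G. G \<subseteq> sphere 0 1 \<and> convex G \<and> x \<in> G}"
  have "\<exists>M\<in>?K. \<forall>X\<in>?K. M \<subseteq> X \<longrightarrow> X = M"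
  proof (rule subset_Zorn_nonempty)
    show "?K \<noteq> {}"
      using x by (auto intro!: exI[of _ "{x}"])
    fix C assume C: "C \<noteq> {}" "subset.chain ?K C"
    then have sub: "C \<subseteq> ?K" and chain: "\<And>X Y. X \<in> C \<Longrightarrow> Y \<in> C \<Longrightarrow> X \<subseteq> Y \<or> Y \<subseteq> X"
      by (auto simp: subset.chain_def)
    have "convex (\<Union>C)"
    proof (rule convexI)
      fix a b and u v :: real
      assume ab: "a \<in> \<Union>C" "b \<in> \<Union>C" and uv: "0 \<le> u" "0 \<le> v" "u + v = 1"
      obtain X where X: "X \<in> C" "a \<in> X" "b \<in> X"
        using ab chain by blast
      with sub have "u *\<^sub>R a + v *\<^sub>R b \<in> X"
        by (intro convexD uv) auto
      with X show "u *\<^sub>R a + v *\<^sub>R b \<in> \<Union>C"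
        by blast
    qed
    then show "\<Union>C \<in> ?K"
      using sub C(1) by blast
  qed
  then obtain M where M: "M \<in> ?K" "\<forall>X\<in>?K. M \<subseteq> X \<longrightarrow> X = M"
    by blast
  then have "M \<in> maximal_convex_subsets"
    unfolding maximal_convex_subsets_def by blast
  with M(1) that show thesis
    by blast
qed

section \<open>Isometries between unit spheres\<close>

lemma norm_convex_comb_eq_1:
  fixes u v :: "'a::real_normed_vector"
  assumes "norm u = 1" "norm v = 1" "norm (u + v) = 2" and "0 \<le> s" "0 \<le> t" "s + t = 1"
  shows "norm (s *\<^sub>R u + t *\<^sub>R v) = 1"
proof -
  have le: "norm (a *\<^sub>R u + b *\<^sub>R v) \<le> 1" if "0 \<le> a" "0 \<le> b" "a + b = 1" for a b
    using norm_triangle_ineq[of "a *\<^sub>R u" "b *\<^sub>R v"] that assms(1,2) by simp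
  \<comment> \<open>The combination and the one with its weights swapped sum to
    \<open>u + v\<close>, of norm 2, and neither has norm above 1.\<close>
  have "(s *\<^sub>R u + t *\<^sub>R v) + (t *\<^sub>R u + s *\<^sub>R v) = (s + t) *\<^sub>R (u + v)"
    by (simp add: algebra_simps)
  then have "2 \<le> norm (s *\<^sub>R u + t *\<^sub>R v) + norm (t *\<^sub>R u + s *\<^sub>R v)"
    using norm_triangle_ineq[of "s *\<^sub>R u + t *\<^sub>R v" "t *\<^sub>R u + s *\<^sub>R v"] assms(3,6) by simp
  then show ?thesis
    using le[of s t] le[of t s] assms(4-6) by simp
qed

text \<open>The whole segment from \<open>u\<close> to \<open>v\<close> lies on the sphere, so it is
  a convex set with a supporting functional.\<close>

lemma exists_common_supporting_functional:
  fixes u v :: "'a::real_normed_vector"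
  assumes "norm u = 1" "norm v = 1" "norm (u + v) = 2"
  obtains g :: "'a \<Rightarrow>\<^sub>L real"
  where "norm g \<le> 1" "blinfun_apply g u = 1" "blinfun_apply g v = 1"
proof -
  have "closed_segment u v \<subseteq> sphere 0 1"
    using norm_convex_comb_eq_1[OF assms] by (auto simp: closed_segment_def)
  then obtain g :: "'a \<Rightarrow>\<^sub>L real" where "g extreme_point_of cball 0 1"
    "\<And>a. a \<in> closed_segment u v \<Longrightarrow> blinfun_apply g a = 1"
    using exists_extreme_supporting_functional[of "closed_segment u v"] by auto
  then show thesis
    using that by (auto simp: extreme_point_of_def)
qed

lemma sum_eq_card_imp_eq:
  fixes f :: "'a \<Rightarrow> real"
  assumes "finite X" "\<And>x. x \<in> X \<Longrightarrow> f x \<le> c" "sum f X \<ge> real (card X) * c" "x \<in> X"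
  shows "f x = c"
proof -
  have "(\<Sum>x\<in>X. c - f x) = 0"
    using assms sum_nonneg[of X "\<lambda>x. c - f x"] by (simp add: sum_subtractf)
  then show ?thesis
    using assms sum_nonneg_eq_0_iff[of X "\<lambda>x. c - f x"] by simp
qed

text \<open>The distance 2 is at most the average of the distances \<open>norm (y - v)\<close>, none
  of which exceeds 2; hence all of them equal 2.\<close>

lemma antipodal_to_mean:
  fixes v :: "'a::real_normed_vector"
  assumes X: "finite X" "X \<subseteq> sphere 0 1" and v: "norm v = 1"
    and mean: "norm ((1 / real (card X)) *\<^sub>R \<Sum>X - v) = 2" and x: "x \<in> X"
  shows "norm (x - v) = 2"
proof (rule sum_eq_card_imp_eq[OF X(1) _ _ x])
  show "norm (y - v) \<le> 2" if "y \<in> X" for y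
    using norm_triangle_ineq4[of y v] that X(2) v by auto
  have n: "real (card X) > 0"
    using X(1) x by (simp add: card_gt_0_iff) blast
  then have "(\<Sum>y\<in>X. y - v) = real (card X) *\<^sub>R ((1 / real (card X)) *\<^sub>R \<Sum>X - v)"
    by (simp add: sum_subtractf algebra_simps sum_constant_scaleR)
  then have "norm (\<Sum>y\<in>X. y - v) = real (card X) * 2"
    using mean n by simp
  then show "real (card X) * 2 \<le> (\<Sum>y\<in>X. norm (y - v))"
    by (metis norm_sum)
qed

text \<open>The functional is built one point of \<open>K\<close> at a time: if \<open>g\<close> supports \<open>y0\<close> and
  \<open>A \<subseteq> K\<close>, the mean \<open>w\<close> of these points satisfies \<open>norm (y0 + w) = 2\<close>, hence
  \<open>norm (b + w) = 2\<close> for the next point \<open>b\<close>; a functional supporting \<open>b\<close> and \<open>w\<close> supports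
  every point of the mean.\<close>

lemma supporting_functional_of_finite:
  fixes y0 :: "'a::real_normed_vector"
  assumes y0: "norm y0 = 1" and K: "finite K" "K \<subseteq> sphere 0 1"
    and star: "\<And>w y. norm w = 1 \<Longrightarrow> norm (y0 + w) = 2 \<Longrightarrow> y \<in> K \<Longrightarrow> norm (y + w) = 2"
  obtains g :: "'a \<Rightarrow>\<^sub>L real"
  where "norm g \<le> 1" "\<And>y. y \<in> K \<Longrightarrow> blinfun_apply g y = 1"
proof -
  \<comment> \<open>Including \<open>y0\<close> in the induction lets the mean of the points so far
    be related to \<open>y0\<close>, to which \<open>star\<close> refers.\<close>
  have "\<exists>g :: 'a \<Rightarrow>\<^sub>L real. norm g \<le> 1 \<and> (\<forall>y\<in>insert y0 K. blinfun_apply g y = 1)"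
    using K(1) order_refl[of K]
  proof (induction rule: finite_subset_induct')
    case empty
    have "norm (y0 + y0) = 2"
      using y0 by (simp flip: scaleR_2)
    then show ?case
      using exists_common_supporting_functional[OF y0 y0] by auto
  next
    case (insert b A)
    then obtain g :: "'a \<Rightarrow>\<^sub>L real" where g: "norm g \<le> 1" "\<And>y. y \<in> insert y0 A \<Longrightarrow> blinfun_apply g y = 1"
      by blast
    let ?Y = "insert y0 A"
    define n where "n = real (card ?Y)"
    have fin: "finite ?Y"
      using insert by simp
    then have n: "n > 0"
      unfolding n_def by (simp add: card_gt_0_iff del: card_insert_disjoint)
    have unit: "norm y = 1" if "y \<in> ?Y" for y
      using that y0 insert(3) K(2) by auto
    define w where "w = (1 / n) *\<^sub>R \<Sum>?Y"
    have apply_w: "blinfun_apply h w = (\<Sum>y\<in>?Y. blinfun_apply h y) / n" for h :: "'a \<Rightarrow>\<^sub>L real"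
      unfolding w_def blinfun.scaleR_right blinfun.sum_right by (simp add: divide_inverse mult.commute)
    \<comment> \<open>The value 1 at the mean keeps \<open>w\<close> on the sphere and gives
      \<open>y0 + w\<close> norm 2.\<close>
    have gw: "blinfun_apply g w = 1"
      unfolding apply_w using g(2) n by (simp add: n_def)
    have "norm (\<Sum>?Y) \<le> (\<Sum>y\<in>?Y. norm y)"
      by (rule norm_sum)
    also have "\<dots> = n"
      using unit by (simp add: n_def)
    finally have "norm w \<le> 1"
      using n by (simp add: w_def)
    then have w: "norm w = 1"
      using blinfun_abs_le_norm[OF g(1), of w] gw by simp
    have "norm (y0 + w) = 2"
      using blinfun_abs_le_norm[OF g(1), of "y0 + w"] g(2)[of y0] gw norm_triangle_ineq[of y0 w] y0 w
      by (simp add: blinfun.add_right)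
    then have "norm (b + w) = 2"
      using star w insert(2) by blast
    moreover have "norm b = 1"
      using insert(2) K(2) by auto
    ultimately obtain h :: "'a \<Rightarrow>\<^sub>L real" where h: "norm h \<le> 1" "blinfun_apply h b = 1" "blinfun_apply h w = 1"
      using exists_common_supporting_functional w by blast
    have "blinfun_apply h y = 1" if "y \<in> ?Y" for y
    proof (rule sum_eq_card_imp_eq[OF fin _ _ that])
      show "blinfun_apply h z \<le> 1" if "z \<in> ?Y" for z
        using blinfun_abs_le_norm[OF h(1), of z] unit[OF that] by simp
      show "real (card ?Y) * 1 \<le> sum (blinfun_apply h) ?Y"
        using h(3) n unfolding apply_w by (simp add: n_def field_simps)
    qed
    then show ?case
      using h by blast
  qed
  then show thesis
    using that by blast
qed

section \<open>Images of maximal convex sets\<close>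

context
  fixes T :: "'a::real_normed_vector \<Rightarrow> 'b::real_normed_vector"
  assumes T: "surjective_isometry_between T (sphere 0 1) (sphere 0 1)"
begin

lemma sphere_isometry_dist:
  "x \<in> sphere 0 1 \<Longrightarrow> y \<in> sphere 0 1 \<Longrightarrow> norm (T x - T y) = norm (x - y)"
  using T by (simp add: surjective_isometry_between_def dist_norm)

lemma sphere_isometry_in: "x \<in> sphere 0 1 \<Longrightarrow> norm (T x) = 1"
  using T by (auto simp: surjective_isometry_between_def)

lemma sphere_isometry_surj:
  assumes "norm y = 1"
  obtains x where "x \<in> sphere 0 1" "T x = y"
  using T assms by (force simp: surjective_isometry_between_def)

lemma sphere_isometry_inj: "inj_on T (sphere 0 1)"
  by (rule inj_onI) (metis sphere_isometry_dist norm_eq_zero right_minus_eq)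

lemma surjective_isometry_inv_into:
  "surjective_isometry_between (inv_into (sphere 0 1) T) (sphere 0 1) (sphere 0 1)"
proof -
  have im: "T ` sphere 0 1 = sphere 0 1"
    using T by (simp add: surjective_isometry_between_def)
  let ?S = "inv_into (sphere 0 1) T"
  have S: "?S y \<in> sphere 0 1" "T (?S y) = y" if "y \<in> sphere 0 1" for y
    using inv_into_into[of y T "sphere 0 1"] f_inv_into_f[of y T "sphere 0 1"] that im by auto
  have "?S ` sphere 0 1 = sphere 0 1"
    using inv_into_image_cancel[OF sphere_isometry_inj order_refl] im by simp
  moreover have "dist (?S x) (?S y) = dist x y" if "x \<in> sphere 0 1" "y \<in> sphere 0 1" for x y
    using sphere_isometry_dist[OF S(1)[OF that(1)] S(1)[OF that(2)]] S(2) that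
    by (simp add: dist_norm)
  ultimately show ?thesis
    by (simp add: surjective_isometry_between_def)
qed

text \<open>By \<open>antipodal_to_mean\<close>, a point antipodal to the image of the mean of finitely many
  points of \<open>C\<close> is antipodal to the image of each of them.\<close>

lemma convex_hull_image_subset_sphere:
  assumes C: "convex C" "C \<subseteq> sphere 0 1"
  shows "convex hull (T ` C) \<subseteq> sphere 0 1"
proof
  fix y assume "y \<in> convex hull (T ` C)"
  then obtain S u where S: "finite S" "S \<subseteq> T ` C" and u: "\<And>v. v \<in> S \<Longrightarrow> 0 \<le> u v" "sum u S = 1"
    and y: "y = (\<Sum>v\<in>S. u v *\<^sub>R v)"
    unfolding convex_hull_explicit by blast
  obtain X where X: "X \<subseteq> C" "finite X" "S = T ` X"
    using finite_subset_image[OF S] by blast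
  have "X \<noteq> {}"
    using u(2) X(3) by auto
  then have n: "real (card X) > 0"
    using X(2) by (simp add: card_gt_0_iff)
  \<comment> \<open>Equal weights suffice whatever \<open>u\<close> is: \<open>T x0\<close> serves
    only as the centre \<open>y0\<close> from which a functional supporting all of \<open>S\<close>
    is built.\<close>
  define x0 where "x0 = (1 / real (card X)) *\<^sub>R \<Sum>X"
  have "(\<Sum>x\<in>X. (1 / real (card X)) *\<^sub>R x) \<in> C"
    using X C(1) n by (intro convex_sum) auto
  then have "x0 \<in> C"
    by (simp add: x0_def scaleR_sum_right)
  then have x0: "x0 \<in> sphere 0 1"
    using C(2) by blast
  have S_sphere: "S \<subseteq> sphere 0 1"
    using X C(2) sphere_isometry_in by auto
  obtain g :: "'b \<Rightarrow>\<^sub>L real"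
    where g: "norm g \<le> 1" "\<And>v. v \<in> S \<Longrightarrow> blinfun_apply g v = 1"
  proof (rule supporting_functional_of_finite[OF sphere_isometry_in[OF x0] S(1) S_sphere])
    fix w z assume w: "norm w = 1" "norm (T x0 + w) = 2" and z: "z \<in> S"
    \<comment> \<open>Pulling back \<open>- w\<close> turns norms of sums with \<open>w\<close> into
      distances to \<open>T v\<close>, which \<open>T\<close> preserves.\<close>
    obtain v where v: "v \<in> sphere 0 1" "T v = - w"
      using sphere_isometry_surj[of "- w"] w(1) by auto
    obtain x where x: "x \<in> X" "z = T x"
      using z X(3) by blast
    have "norm (x0 - v) = 2"
      using sphere_isometry_dist[OF x0 v(1)] v(2) w(2) by simp
    then have "norm (x - v) = 2"
      using antipodal_to_mean[of X v x] X C(2) v(1) x(1) by (auto simp: x0_def)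
    then show "norm (z + w) = 2"
      using sphere_isometry_dist[of x v] x X(1) C(2) v by auto
  qed blast
  have "norm y \<le> (\<Sum>v\<in>S. norm (u v *\<^sub>R v))"
    unfolding y by (rule norm_sum)
  also have "\<dots> = sum u S"
    using u(1) S_sphere by (intro sum.cong) auto
  finally have "norm y \<le> 1"
    using u(2) by simp
  moreover have "blinfun_apply g y = 1"
    unfolding y blinfun.sum_right using u(2) g(2) by (simp add: blinfun.scaleR_right)
  ultimately show "y \<in> sphere 0 1"
    using blinfun_abs_le_norm[OF g(1), of y] by simp
qed

end

lemma sphere_isometry_maximal_convex_subset:
  fixes T :: "'a::real_normed_vector \<Rightarrow> 'b::real_normed_vector"
  assumes T: "surjective_isometry_between T (sphere 0 1) (sphere 0 1)"
    and F: "F \<in> maximal_convex_subsets"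
  shows "T ` F \<in> maximal_convex_subsets"
proof -
  note FD = maximal_convex_subsetsD[OF F]
  let ?S = "inv_into (sphere 0 1) T"
  have im: "T ` sphere 0 1 = sphere 0 1"
    using T by (simp add: surjective_isometry_between_def)
  have max: "G = T ` F" if G: "convex G" "G \<subseteq> sphere 0 1" "T ` F \<subseteq> G" for G
  proof -
    have "F = ?S ` T ` F"
      using inv_into_image_cancel[OF sphere_isometry_inj[OF T] FD(1)] by simp
    also have "\<dots> \<subseteq> ?S ` G"
      using G(3) by (rule image_mono)
    finally have "F \<subseteq> convex hull (?S ` G)"
      using hull_subset by (rule subset_trans)
    moreover have "convex hull (?S ` G) \<subseteq> sphere 0 1"
      using convex_hull_image_subset_sphere[OF surjective_isometry_inv_into[OF T] G(1,2)] .
    ultimately have "convex hull (?S ` G) = F"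
      by (intro FD(3)) auto
    then have "?S ` G \<subseteq> F"
      using hull_subset[of "?S ` G" convex] by simp
    then have "T ` ?S ` G \<subseteq> T ` F"
      by (rule image_mono)
    moreover have "T ` ?S ` G = G"
      using G(2) im by (intro image_inv_into_cancel)
    ultimately show ?thesis
      using G(3) by blast
  qed
  have "convex hull (T ` F) = T ` F"
    using convex_hull_image_subset_sphere[OF T FD(2,1)] by (intro max hull_subset) auto
  then have "convex (T ` F)"
    by (metis convex_convex_hull)
  moreover have "T ` F \<subseteq> sphere 0 1"
    using FD(1) im by blast
  ultimately show ?thesis
    using max by (auto simp: maximal_convex_subsets_def)
qed

lemma maximal_convex_subset_uminus:
  assumes F: "(F :: 'a::real_normed_vector set) \<in> maximal_convex_subsets"
  shows "uminus ` F \<in> maximal_convex_subsets"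
proof -
  have cancel: "uminus ` uminus ` A = A" for A :: "'a set"
    by (simp add: image_image)
  have sub: "uminus ` A \<subseteq> sphere 0 1" if "A \<subseteq> sphere 0 1" for A :: "'a set"
    using that by auto
  have "G = uminus ` F" if G: "G \<subseteq> sphere 0 1" "convex G" "uminus ` F \<subseteq> G" for G
  proof -
    have "F \<subseteq> uminus ` G"
      using image_mono[OF G(3), of uminus] by (simp only: cancel)
    then have "uminus ` G = F"
      by (rule maximal_convex_subsetsD(3)[OF F sub[OF G(1)] convex_negations[OF G(2)]])
    then show ?thesis
      using cancel by metis
  qed
  then show ?thesis
    using sub[OF maximal_convex_subsetsD(1)[OF F]]
      convex_negations[OF maximal_convex_subsetsD(2)[OF F]]
    unfolding maximal_convex_subsets_def by blast
qed

text \<open>The midpoints of \<open>G\<close> and \<open>H\<close> form a convex subset of the sphere, and a functional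
  supporting it supports both sets.\<close>

lemma maximal_convex_subsets_eqI:
  fixes G H :: "'a::real_normed_vector set"
  assumes G: "G \<in> maximal_convex_subsets" "G \<noteq> {}" and H: "H \<in> maximal_convex_subsets" "H \<noteq> {}"
    and two: "\<And>u v. u \<in> G \<Longrightarrow> v \<in> H \<Longrightarrow> norm (u + v) = 2"
  shows "G = H"
proof -
  note GD = maximal_convex_subsetsD[OF G(1)] and HD = maximal_convex_subsetsD[OF H(1)]
  define M where "M = (\<lambda>z. (1 / 2) *\<^sub>R z) ` (\<Union>u\<in>G. \<Union>v\<in>H. {u + v})"
  have mem: "(1 / 2) *\<^sub>R (u + v) \<in> M" if "u \<in> G" "v \<in> H" for u v
    using that by (auto simp: M_def)
  have "convex M"
    unfolding M_def by (intro convex_scaling convex_sums GD HD)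
  moreover have "M \<noteq> {}"
    using mem G(2) H(2) by blast
  moreover have "M \<subseteq> sphere 0 1"
    using two by (auto simp: M_def)
  ultimately obtain p :: "'a \<Rightarrow>\<^sub>L real"
    where p: "p extreme_point_of cball 0 1" "\<And>a. a \<in> M \<Longrightarrow> blinfun_apply p a = 1"
    using exists_extreme_supporting_functional by blast
  have norm: "norm p \<le> 1"
    using p(1) by (simp add: extreme_point_of_def)
  have *: "blinfun_apply p u = 1 \<and> blinfun_apply p v = 1" if "u \<in> G" "v \<in> H" for u v
  proof -
    have "blinfun_apply p u + blinfun_apply p v = 2"
      using p(2)[OF mem[OF that]] by (simp add: blinfun.add_right blinfun.scaleR_right)
    moreover have "norm u = 1" "norm v = 1"
      using that GD(1) HD(1) by auto
    ultimately show ?thesis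
      using blinfun_abs_le_norm[OF norm, of u] blinfun_abs_le_norm[OF norm, of v] by simp
  qed
  have "G = face p 1"
    using * H(2) by (intro maximal_convex_subset_eq_face[OF G(1) norm]) blast
  also have "\<dots> = H"
    using * G(2) by (intro maximal_convex_subset_eq_face[OF H(1) norm, symmetric]) blast
  finally show ?thesis .
qed

text \<open>For \<open>x\<close> and \<open>y\<close> in \<open>F\<close> the midpoint has norm 1,
  so \<open>- x\<close> and \<open>y\<close> are at distance 2, and so are their images. This is the
  criterion for equality of two maximal convex sets.\<close>

lemma sphere_isometry_image_uminus:
  fixes T :: "'a::real_normed_vector \<Rightarrow> 'b::real_normed_vector"
  assumes T: "surjective_isometry_between T (sphere 0 1) (sphere 0 1)"
    and F: "F \<in> maximal_convex_subsets" "F \<noteq> {}"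
  shows "T ` uminus ` F = uminus ` T ` F"
proof (rule maximal_convex_subsets_eqI)
  show "T ` uminus ` F \<in> maximal_convex_subsets" "uminus ` T ` F \<in> maximal_convex_subsets"
    using F(1) by (auto intro!: sphere_isometry_maximal_convex_subset[OF T]
      maximal_convex_subset_uminus)
  fix u v assume "u \<in> T ` uminus ` F" "v \<in> uminus ` T ` F"
  then obtain x y where xy: "x \<in> F" "y \<in> F" "u = T (- x)" "v = - T y"
    by blast
  have unit: "x \<in> sphere 0 1" "y \<in> sphere 0 1"
    using maximal_convex_subsetsD(1)[OF F(1)] xy by auto
  have "(1 / 2) *\<^sub>R x + (1 / 2) *\<^sub>R y \<in> F"
    using xy by (intro convexD maximal_convex_subsetsD(2)[OF F(1)]) auto
  then have "norm ((1 / 2) *\<^sub>R (x + y)) = 1"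
    using maximal_convex_subsetsD(1)[OF F(1)] by (auto simp: scaleR_add_right)
  then have "norm (- x - y) = 2"
    by (simp add: norm_minus_commute[of "- x"] add.commute)
  then show "norm (u + v) = 2"
    using sphere_isometry_dist[OF T, of "- x" y] unit xy by simp
qed (use F in auto)

section \<open>Transfer of functionals and linear extension\<close>

lemma pullback_functional:
  fixes T :: "'a::real_normed_vector \<Rightarrow> 'b::real_normed_vector"
  assumes T: "surjective_isometry_between T (sphere 0 1) (sphere 0 1)"
    and p: "p \<in> supporting_extreme_points"
    and M: "\<And>\<alpha>. - 1 \<le> \<alpha> \<Longrightarrow> \<alpha> \<le> 1 \<Longrightarrow> {a \<in> sphere 0 1. blinfun_apply p a = \<alpha>} \<subseteq> M_set p \<alpha>"
    and ne: "sphere (0::'a) 1 \<noteq> {}"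
  obtains q where "\<And>a. a \<in> sphere 0 1 \<Longrightarrow> blinfun_apply q (T a) = blinfun_apply p a"
proof -
  have F: "face p 1 \<in> maximal_convex_subsets"
    using p by (simp add: supporting_extreme_points_def)
  then have F_ne: "face p 1 \<noteq> {}"
    using ne maximal_convex_subset_nonempty by blast
  \<comment> \<open>The functional sought is one that cuts out the image of the face of
    \<open>p\<close>.\<close>
  obtain q where q: "q \<in> supporting_extreme_points" "T ` face p 1 = face q 1"
    using maximal_convex_subset_is_extreme_face[of "T ` face p 1"]
      sphere_isometry_maximal_convex_subset[OF T F] F_ne by blast
  have neg: "face p (- 1) = uminus ` face p 1"
    unfolding face_scaleR_minus_one[symmetric] by (auto simp: face_def blinfun.minus_left)
  have on_face: "blinfun_apply q (T b) = e" if "e = 1 \<or> e = - 1" "b \<in> face p e" for b e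
    using that(1)
  proof
    assume e: "e = 1"
    then have "T b \<in> face q 1"
      using that(2) q(2) by blast
    then show ?thesis
      using e by (simp add: face_def)
  next
    assume e: "e = - 1"
    then have "T b \<in> T ` uminus ` face p 1"
      using that(2) neg by simp
    then have "T b \<in> uminus ` face q 1"
      using sphere_isometry_image_uminus[OF T F F_ne] q(2) by simp
    then show ?thesis
      using e by (auto simp: face_def blinfun.minus_right)
  qed
  have bound: "\<bar>blinfun_apply q (T a) - e\<bar> \<le> infdist a (face p e)"
    if "e = 1 \<or> e = - 1" "a \<in> sphere 0 1" for a e
  proof -
    \<comment> \<open>Nonemptiness matters: \<open>infdist\<close> to the empty set is 0 by
      convention.\<close>
    have "face p e \<noteq> {}"
      using that(1) F_ne neg by auto
    then show ?thesis
      unfolding infdist_notempty[OF \<open>face p e \<noteq> {}\<close>]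
    proof (rule cINF_greatest)
      fix b assume b: "b \<in> face p e"
      have "\<bar>blinfun_apply q (T a) - e\<bar> = \<bar>blinfun_apply q (T a - T b)\<bar>"
        using on_face[OF that(1) b] by (simp add: blinfun.diff_right)
      also have "\<dots> \<le> norm (T a - T b)"
        using supporting_extreme_points_norm[OF q(1)] by (rule blinfun_abs_le_norm)
      also have "\<dots> = dist a b"
        using sphere_isometry_dist[OF T that(2), of b] b by (simp add: dist_norm face_def)
      finally show "\<bar>blinfun_apply q (T a) - e\<bar> \<le> dist a b" .
    qed
  qed
  have "blinfun_apply q (T a) = blinfun_apply p a" if a: "a \<in> sphere 0 1" for a
  proof -
    define \<alpha> where "\<alpha> = blinfun_apply p a"
    have "\<bar>\<alpha>\<bar> \<le> 1"
      using blinfun_abs_le_norm[OF supporting_extreme_points_norm[OF p], of a] a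
      by (simp add: \<alpha>_def)
    then have "{a \<in> sphere 0 1. blinfun_apply p a = \<alpha>} \<subseteq> M_set p \<alpha>"
      by (intro M) auto
    then have "a \<in> M_set p \<alpha>"
      using a \<alpha>_def by blast
    then have d: "infdist a (face p (direction \<alpha>)) \<le> 1 - \<bar>\<alpha>\<bar>"
      "infdist a (face p (- direction \<alpha>)) \<le> 1 + \<bar>\<alpha>\<bar>"
      by (auto simp: M_set_def)
    \<comment> \<open>For \<alpha> \<ge> 0, the distance to the face at 1 gives
      \<open>q (T a)\<close> \<ge> 1 - (1 - \<alpha>), and that to the face at -1 gives
      \<open>q (T a)\<close> \<le> -1 + (1 + \<alpha>). For \<alpha> \<le> 0 with direction -1 the
      roles swap.\<close>
    have "direction \<alpha> = 1 \<and> \<alpha> \<ge> 0 \<or> direction \<alpha> = - 1 \<and> \<alpha> \<le> 0"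
      by (auto simp: direction_def abs_if)
    then have "blinfun_apply q (T a) = \<alpha>"
      using d bound[OF _ a, of "direction \<alpha>"] bound[OF _ a, of "- direction \<alpha>"] by auto
    then show ?thesis
      by (simp add: \<alpha>_def)
  qed
  then show thesis
    by (rule that)
qed

text \<open>Each pair with \<open>q\<close> after \<open>T\<close> equal to \<open>p\<close> on the
  sphere has \<open>q\<close> after \<open>U\<close> equal to \<open>p\<close> everywhere. As such
  \<open>q\<close> separate points, linearity of the \<open>p\<close> passes to
  \<open>U\<close>.\<close>

lemma homogeneous_extension_is_linear_isometry:
  fixes T :: "'a::real_normed_vector \<Rightarrow> 'b::real_normed_vector"
  assumes T: "surjective_isometry_between T (sphere 0 1) (sphere 0 1)"
    and sep: "\<And>z :: 'b. z \<noteq> 0 \<Longrightarrow> \<exists>q p. blinfun_apply q z \<noteq> (0::real) \<and>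
      (\<forall>a\<in>sphere 0 1. blinfun_apply q (T a) = blinfun_apply p a)"
  shows "extends_to_linear_isometry T"
proof -
  \<comment> \<open>The factor \<open>norm x\<close> makes \<open>U 0 = 0\<close> whatever
    \<open>T\<close> does at 0.\<close>
  define U where "U x = norm x *\<^sub>R T (sgn x)" for x
  have sgn: "sgn x \<in> sphere 0 1" if "x \<noteq> 0" for x :: 'a
    using that by (simp add: norm_sgn)
  have U: "blinfun_apply q (U x) = blinfun_apply p x"
    if "\<forall>a\<in>sphere 0 1. blinfun_apply q (T a) = blinfun_apply p a"
    for q :: "'b \<Rightarrow>\<^sub>L real" and p x
  proof (cases "x = 0")
    case False
    have "blinfun_apply q (U x) = norm x * blinfun_apply p (sgn x)"
      using that sgn[OF False] by (simp add: U_def blinfun.scaleR_right)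
    also have "\<dots> = blinfun_apply p x"
      using False by (simp add: sgn_div_norm blinfun.scaleR_right)
    finally show ?thesis .
  qed (simp add: U_def blinfun.zero_right)
  have eqI: "y = z" if "\<And>(q :: 'b \<Rightarrow>\<^sub>L real) p. (\<And>x. blinfun_apply q (U x) = blinfun_apply p x) \<Longrightarrow>
      blinfun_apply q y = blinfun_apply q z" for y z
  proof (rule ccontr)
    assume "y \<noteq> z"
    then obtain q :: "'b \<Rightarrow>\<^sub>L real" and p where "blinfun_apply q (y - z) \<noteq> 0"
      "\<forall>a\<in>sphere 0 1. blinfun_apply q (T a) = blinfun_apply p a"
      using sep[of "y - z"] by auto
    then show False
      using that[of q p] U[of q p] by (auto simp: blinfun.diff_right)
  qed
  have lin: "linear U"
  proof
    show "U (x + y) = U x + U y" for x y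
      by (rule eqI) (simp add: blinfun.add_right)
    show "U (k *\<^sub>R x) = k *\<^sub>R U x" for k x
      by (rule eqI) (simp add: blinfun.scaleR_right)
  qed
  have norm_U: "norm (U x) = norm x" for x
    using sphere_isometry_in[OF T sgn[of x]] by (cases "x = 0") (auto simp: U_def)
  have ext: "U a = T a" if "a \<in> sphere 0 1" for a
    using that by (simp add: U_def sgn_div_norm)
  have "\<exists>x. U x = y" for y
  proof (cases "y = 0")
    case True
    then show ?thesis
      using linear_0[OF lin] by blast
  next
    case False
    then obtain a where "a \<in> sphere 0 1" "T a = sgn y"
      using sphere_isometry_surj[OF T, of "sgn y"] by (auto simp: norm_sgn)
    then have "U (norm y *\<^sub>R a) = y"
      using False ext by (simp add: linear_cmul[OF lin] sgn_div_norm)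
    then show ?thesis
      by blast
  qed
  then have "surj U"
    by (metis surjI)
  moreover have "dist (U x) (U y) = dist x y" for x y
    using norm_U[of "x - y"] linear_diff[OF lin, of x y] by (simp add: dist_norm)
  ultimately have "surjective_isometry_between U UNIV UNIV"
    by (simp add: surjective_isometry_between_def)
  with lin ext show ?thesis
    unfolding extends_to_linear_isometry_def by blast
qed

text \<open>The representative of the class may cut out \<open>F\<close> or its negative, hence the
  absolute value.\<close>

lemma set_of_representatives_face:
  assumes P: "set_of_representatives P" and F: "F \<in> maximal_convex_subsets" "F \<noteq> {}"
  obtains p where "p \<in> P" "\<And>a. a \<in> F \<Longrightarrow> \<bar>blinfun_apply p a\<bar> = 1"
proof -
  obtain p0 where p0: "p0 \<in> supporting_extreme_points" "F = face p0 1"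
    using maximal_convex_subset_is_extreme_face[OF F] .
  have "face_equiv `` {p0} \<in> supporting_extreme_points // face_equiv"
    using p0(1) by (rule quotientI)
  then obtain p where p: "p \<in> P" "(p0, p) \<in> face_equiv"
    using P unfolding set_of_representatives_def by blast
  then obtain \<gamma> :: real where "\<gamma> \<in> {1, - 1}" "F = face (\<gamma> *\<^sub>R p) 1"
    using p0(2) unfolding face_equiv_def by blast
  then have "\<bar>blinfun_apply p a\<bar> = 1" if "a \<in> F" for a
    using that by (auto simp: face_def blinfun.scaleR_left)
  with p(1) that show thesis
    by blast
qed

theorem proposition5p1:
  fixes P1 :: "('a::banach \<Rightarrow>\<^sub>L real) set"
  assumes "set_of_representatives P1"
    and "\<forall>p\<in>P1. \<forall>\<alpha>::real. -1 \<le> \<alpha> \<and> \<alpha> \<le> 1 \<longrightarrow>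
           M_set p \<alpha> = {a \<in> sphere 0 1. blinfun_apply p a = \<alpha>}"
  shows "(\<forall>T :: 'a \<Rightarrow> 'b::banach.
            surjective_isometry_between T (sphere 0 1) (sphere 0 1) \<longrightarrow>
            (\<exists>U. linear U \<and> surjective_isometry_between U UNIV UNIV \<and>
                 (\<forall>a\<in>sphere 0 1. U a = T a)))
         \<and> mazur_ulam TYPE('a) TYPE('b)"
proof -
  have "extends_to_linear_isometry T"
    if T: "surjective_isometry_between T (sphere 0 1) (sphere 0 1)" for T :: "'a \<Rightarrow> 'b"
  proof (rule homogeneous_extension_is_linear_isometry[OF T])
    fix z :: 'b assume z: "z \<noteq> 0"
    \<comment> \<open>To separate \<open>z\<close> from 0, take a maximal convex set through the
      preimage \<open>x\<close> of \<open>sgn z\<close>: its representative \<open>p\<close> has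
      value 1 or -1 at \<open>x\<close>, and \<open>q\<close> has the same value at
      \<open>sgn z\<close>.\<close>
    obtain x where x: "x \<in> sphere 0 1" "T x = sgn z"
      using sphere_isometry_surj[OF T, of "sgn z"] z by (auto simp: norm_sgn)
    obtain F where F: "F \<in> maximal_convex_subsets" "x \<in> F"
      using exists_maximal_convex_subset[OF x(1)] .
    obtain p where p: "p \<in> P1" "\<bar>blinfun_apply p x\<bar> = 1"
      using set_of_representatives_face[OF assms(1) F(1)] F(2) by blast
    have supp: "p \<in> supporting_extreme_points"
      using p(1) assms(1) by (auto simp: set_of_representatives_def)
    have sub: "{a \<in> sphere 0 1. blinfun_apply p a = \<alpha>} \<subseteq> M_set p \<alpha>" if "- 1 \<le> \<alpha>" "\<alpha> \<le> 1" for \<alpha>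
      using assms(2) p(1) that by simp
    have "sphere (0::'a) 1 \<noteq> {}"
      using x(1) by blast
    then obtain q where q: "\<And>a. a \<in> sphere 0 1 \<Longrightarrow> blinfun_apply q (T a) = blinfun_apply p a"
      using pullback_functional[OF T supp sub] by blast
    have "blinfun_apply q (sgn z) \<noteq> 0"
      using q[OF x(1)] x(2) p(2) by auto
    then have "blinfun_apply q z \<noteq> 0"
      by (simp add: sgn_div_norm blinfun.scaleR_right)
    then show "\<exists>q p. blinfun_apply q z \<noteq> (0::real) \<and>
        (\<forall>a\<in>sphere 0 1. blinfun_apply q (T a) = blinfun_apply p a)"
      using q by blast
  qed
  then show ?thesis
    by (simp add: mazur_ulam_def extends_to_linear_isometry_def)
qed

end
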